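(* Let $f:L\rightarrow L$ be a continuous map, where $L$ is the combinatorial model of the real line. Then $f$ does not have periodic points of period $n$ for any integer $n\geq 3$.
   Context: $L=\{x_i\}_{i\in\mathbb{Z}}$ (the $x_i$ pairwise distinct) is the poset, called the combinatorial model of the real line, whose only strict relations are $x_i<x_{i+1}>x_{i+2}$ for every odd $i\in\mathbb{Z}$; thus points of odd index are minimal, points of even index are maximal, and each even-indexed $x_i$ lies above exactly $x_{i-1}$ and $x_{i+1}$. $L$ is regarded as an Alexandroff $T_0$-space, the smallest open set containing $x$ being $U_x=\{y\in L: y\leq x\}$; a map $f:L\to L$ is continuous if and only if it is order-preserving ($x\leq y$ implies $f(x)\leq f(y)$). A point $x$ is a periodic point of period $n$ of $f$ if $n$ is the smallest positive integer with $f^n(x)=x$. *)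

theory Defs
  imports Complex_Main
begin

datatype line_model = x_pt int

instantiation line_model :: order
begin

definition less_line_model :: "line_model \<Rightarrow> line_model \<Rightarrow> bool" where
  "a < b \<longleftrightarrow>
     (\<exists>i. odd i \<and> (a = x_pt i \<and> b = x_pt (i + 1) \<or> a = x_pt (i + 2) \<and> b = x_pt (i + 1)))"

definition less_eq_line_model :: "line_model \<Rightarrow> line_model \<Rightarrow> bool" where
  "a \<le> b \<longleftrightarrow> a < b \<or> a = (b :: line_model)"

instance
proof
  have *: "\<not> (a < b \<and> b < c)" for a b c :: line_model
  proof
    assume "a < b \<and> b < c"
    then obtain i j where "odd i" "b = x_pt (i + 1)" "odd j" "b = x_pt j \<or> b = x_pt (j + 2)"
      by (auto simp: less_line_model_def)
    then show False
      by auto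
  qed
  fix a b c :: line_model
  show "a < b \<longleftrightarrow> a \<le> b \<and> \<not> b \<le> a"
    using *[of a b a] *[of a a a] by (auto simp: less_eq_line_model_def)
  show "a \<le> a"
    unfolding less_eq_line_model_def by blast
  show "a \<le> c" if "a \<le> b" "b \<le> c"
    using that * unfolding less_eq_line_model_def by blast
  show "a = b" if "a \<le> b" "b \<le> a"
    using that * unfolding less_eq_line_model_def by blast
qed

end

text \<open>The Alexandroff topology of the poset. The open sets are the down-sets, so that
  \<open>{y. y \<le> x}\<close> is the smallest open set containing \<open>x\<close>.\<close>

instantiation line_model :: topological_space
begin

definition open_line_model :: "line_model set \<Rightarrow> bool" where
  "open (S :: line_model set) \<longleftrightarrow> (\<forall>x\<in>S. \<forall>y\<le>x. y \<in> S)"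

instance
  by standard (auto simp: open_line_model_def)

end

lemma open_atMost_line_model: "open {..x :: line_model}"
  by (auto simp: open_line_model_def)

lemma smallest_open_line_model:
  fixes x :: line_model
  assumes "open S" "x \<in> S"
  shows "{..x} \<subseteq> S"
  using assms by (auto simp: open_line_model_def)

instance line_model :: t0_space
proof
  fix x y :: line_model
  assume "x \<noteq> y"
  then have "\<not> x \<le> y \<or> \<not> y \<le> x"
    by auto
  then show "\<exists>U. open U \<and> \<not> (x \<in> U \<longleftrightarrow> y \<in> U)"
    using open_atMost_line_model by (metis atMost_iff order_refl)
qed

lemma continuous_on_line_model_iff_mono:
  fixes f :: "line_model \<Rightarrow> line_model"
  shows "continuous_on UNIV f \<longleftrightarrow> mono f"
proof
  assume cont: "continuous_on UNIV f"
  show "mono f"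
  proof
    fix x y :: line_model
    assume "x \<le> y"
    have "open (f -` {..f y})"
      using cont open_atMost_line_model by (simp add: continuous_on_open_vimage)
    then show "f x \<le> f y"
      using \<open>x \<le> y\<close> by (auto simp: open_line_model_def)
  qed
next
  assume "mono f"
  then show "continuous_on UNIV f"
    by (auto simp: continuous_on_open_vimage open_line_model_def dest: monoD)
qed

lemma even_point_above_iff:
  assumes "even i"
  shows "a < x_pt i \<longleftrightarrow> a = x_pt (i - 1) \<or> a = x_pt (i + 1)"
proof
  assume "a < x_pt i"
  then show "a = x_pt (i - 1) \<or> a = x_pt (i + 1)"
    by (auto simp: less_line_model_def)
next
  assume "a = x_pt (i - 1) \<or> a = x_pt (i + 1)"
  then show "a < x_pt i"
    using assms by (auto simp: less_line_model_def intro!: exI[of _ "i - 1"])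
qed

lemma odd_point_minimal:
  assumes "odd i"
  shows "\<not> a < x_pt i"
  using assms by (auto simp: less_line_model_def)

definition periodic_point :: "('a \<Rightarrow> 'a) \<Rightarrow> nat \<Rightarrow> 'a \<Rightarrow> bool" where
  "periodic_point f n x \<longleftrightarrow>
     0 < n \<and> (f ^^ n) x = x \<and> (\<forall>m. 0 < m \<and> m < n \<longrightarrow> (f ^^ m) x \<noteq> x)"

end

theory Submission
  imports Defs
begin

text \<open>
  Comparable points of the line model have indices at distance at most one, and neighbouring
  points are comparable, so an order-preserving map does not increase distances between indices
  (\<open>mono_line_nonexpanding\<close>). Along a periodic orbit a nonexpanding map must preserve distances:
  they can never grow, and after one period they return to their original value. An isometry of
  a finite set of integers is the restriction of the identity or of a reflection, so applying it
  twice gives the identity (\<open>periodic_nonexpanding_orbit\<close>), and every period is at most two.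
\<close>

text \<open>The sequence is to be thought of as the orbit of a point under a nonexpanding map of an
  ordered ring. If \<open>a 2 \<noteq> a 0\<close>, constancy of distances forbids the orbit ever to turn back, so it
  walks with constant step in one direction, which periodicity does not allow unless the step
  is zero.\<close>

lemma periodic_nonexpanding_orbit:
  fixes a :: "nat \<Rightarrow> 'a::linordered_idom"
  assumes nonexp: "\<And>j k. \<bar>a (Suc j) - a (Suc k)\<bar> \<le> \<bar>a j - a k\<bar>"
    and periodic: "\<And>k. a (k + n) = a k"
    and "n > 0"
  shows "a 2 = a 0"
proof (rule ccontr)
  assume turn: "a 2 \<noteq> a 0"
  have shrink: "\<bar>a (j + m) - a (k + m)\<bar> \<le> \<bar>a j - a k\<bar>" for j k m
  proof (induction m)
    case (Suc m)
    show ?case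
      using nonexp[of "j + m" "k + m"] Suc by simp
  qed simp
  \<comment> \<open>The distance after one more step is squeezed between its value now and its value
    a full period later, which is the same.\<close>
  have step: "\<bar>a (Suc j) - a (Suc k)\<bar> = \<bar>a j - a k\<bar>" for j k
  proof (rule antisym[OF nonexp])
    have "\<bar>a j - a k\<bar> = \<bar>a (Suc j + (n - 1)) - a (Suc k + (n - 1))\<bar>"
      using \<open>n > 0\<close> periodic by simp
    also have "\<dots> \<le> \<bar>a (Suc j) - a (Suc k)\<bar>"
      by (rule shrink)
    finally show "\<bar>a j - a k\<bar> \<le> \<bar>a (Suc j) - a (Suc k)\<bar>" .
  qed
  have no_return: "a (Suc (Suc k)) \<noteq> a k" for k
  proof (induction k)
    case 0
    then show ?case
      using turn by (simp add: numeral_2_eq_2)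
  next
    case (Suc k)
    then show ?case
      using step[of "Suc (Suc k)" k] by auto
  qed
  define d where "d = a 1 - a 0"
  have const: "a (Suc k) - a k = d" for k
  proof (induction k)
    case 0
    then show ?case
      by (simp add: d_def)
  next
    case (Suc k)
    have "a (Suc (Suc k)) - a (Suc k) = a (Suc k) - a k
        \<or> a (Suc (Suc k)) - a (Suc k) = - (a (Suc k) - a k)"
      using step[of "Suc k" k] by (simp only: abs_eq_iff)
    with no_return[of k] Suc show ?case
      by auto
  qed
  have linear: "a k = a 0 + of_nat k * d" for k
  proof (induction k)
    case (Suc k)
    then show ?case
      using const[of k] by (simp add: algebra_simps)
  qed simp
  have "of_nat n * d = 0"
    using linear[of n] periodic[of 0] by simp
  then have "d = 0"
    using \<open>n > 0\<close> by simp
  then show False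
    using linear[of 2] turn by simp
qed

primrec index :: "line_model \<Rightarrow> int" where
  "index (x_pt i) = i"

lemma index_inject: "index x = index y \<longleftrightarrow> x = y"
  by (cases x; cases y) simp

lemma index_le_dist: "x \<le> y \<Longrightarrow> \<bar>index x - index y\<bar> \<le> 1"
  by (auto simp: less_eq_line_model_def less_line_model_def)

lemma neighbours_comparable: "x_pt i \<le> x_pt (i + 1) \<or> x_pt (i + 1) \<le> x_pt i"
proof (cases "even i")
  case True
  then show ?thesis
    using even_point_above_iff[of i "x_pt (i + 1)"] by (simp add: less_imp_le)
next
  case False
  then show ?thesis
    using even_point_above_iff[of "i + 1" "x_pt i"] by (simp add: less_imp_le)
qed

lemma mono_line_nonexpanding:
  fixes f :: "line_model \<Rightarrow> line_model"
  assumes "mono f"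
  shows "\<bar>index (f x) - index (f y)\<bar> \<le> \<bar>index x - index y\<bar>"
proof -
  have step: "\<bar>index (f (x_pt (i + 1))) - index (f (x_pt i))\<bar> \<le> 1" for i
    using neighbours_comparable[of i] index_le_dist monoD[OF assms]
    by (metis abs_minus_commute)
  have upward: "\<bar>index (f (x_pt (i + int k))) - index (f (x_pt i))\<bar> \<le> int k" for i k
  proof (induction k)
    case (Suc k)
    then show ?case
      using step[of "i + int k"] by (simp add: add.assoc add.commute[of 1])
  qed simp
  obtain i j where xy: "x = x_pt i" "y = x_pt j"
    by (meson line_model.exhaust)
  show ?thesis
    using upward[of i "nat (j - i)"] upward[of j "nat (i - j)"]
    by (cases "i \<le> j") (auto simp: xy)
qed

theorem theorem3p4:
  fixes f :: "line_model \<Rightarrow> line_model" and n :: nat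
  assumes "continuous_on UNIV f"
    and "n \<ge> 3"
  shows "\<not> (\<exists>x. periodic_point f n x)"
proof
  assume "\<exists>x. periodic_point f n x"
  then obtain x where fix_n: "(f ^^ n) x = x"
    and least: "\<And>m. 0 < m \<Longrightarrow> m < n \<Longrightarrow> (f ^^ m) x \<noteq> x"
    by (auto simp: periodic_point_def)
  have "mono f"
    using assms(1) continuous_on_line_model_iff_mono by blast
  then have "index ((f ^^ 2) x) = index ((f ^^ 0) x)"
    using \<open>n \<ge> 3\<close> fix_n
    by (intro periodic_nonexpanding_orbit[where n = n])
      (auto simp: funpow_add intro: mono_line_nonexpanding)
  then have "(f ^^ 2) x = x"
    by (simp add: index_inject)
  then show False
    using least[of 2] \<open>n \<ge> 3\<close> by simp
qed

end
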